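(* Let $n_1$ and $n_2$ be two positive integers such that $\mathrm{rad}(n_1)\mid n_2$ and $n_2\mid n_1$. Then, for every integer $a$, the integer $\alpha_{n_1}(a)$ divides $\alpha_{n_2}(a)$.
   Context: For a positive integer $n$, $\mathrm{rad}(n)=\prod_{p\mid n,\ p\text{ prime}}p$ is the largest square-free divisor of $n$. For an integer $a$ coprime to $n$, $\mathcal{O}_n(a)$ is the multiplicative order of $a$ modulo $n$, i.e. the smallest positive integer $e$ with $a^e\equiv 1\pmod n$. The function $\alpha_n:\mathbb{Z}\to\mathbb{N}$ is defined by $\alpha_n(a)=\mathcal{O}_n(a^n)$ if $\gcd(a,n)=1$, and $\alpha_n(a)=0$ otherwise. Conventions: $\gcd(0,n)=n$; $0$ divides $0$. *)

theory Defs
  imports "HOL-Number_Theory.Number_Theory"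
begin

definition rad :: "nat \<Rightarrow> nat" where
  "rad n = \<Prod>(prime_factors n)"

text \<open>
  The library's \<open>ord\<close> is used at type \<^typ>\<open>int\<close>, so that bases may be negative or zero.
  For \<open>n = 1\<close> every \<open>a\<close> is coprime to \<open>n\<close>, and the order is \<open>1\<close>.
\<close>
definition alpha :: "nat \<Rightarrow> int \<Rightarrow> nat" where
  "alpha n a = (if coprime a (int n) then ord (int n) (a ^ n) else 0)"

end

theory Submission
  imports Defs
begin

text \<open>
  If \<open>b \<equiv> 1\<close> modulo \<open>N\<close> and \<open>p\<close> divides \<open>N\<close>, then \<open>b ^ p \<equiv> 1\<close> modulo \<open>p N\<close>, because the second
  factor of \<open>b ^ p - 1 = (b - 1) (1 + b + \<dots> + b ^ (p - 1))\<close> is \<open>\<equiv> p \<equiv> 0\<close> modulo \<open>p\<close>. Iterating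
  over the prime factors of \<open>n1 / n2\<close>, all of which divide \<open>n2\<close>, lifts the congruence
  \<open>(a ^ n2) ^ d \<equiv> 1\<close> modulo \<open>n2\<close>, with \<open>d = alpha n2 a\<close>, to \<open>(a ^ n1) ^ d \<equiv> 1\<close> modulo \<open>n1\<close>.
\<close>

lemma cong_1_power_lift:
  fixes b :: int and N p :: nat
  assumes "[b = 1] (mod int N)" and "p dvd N"
  shows "[b ^ p = 1] (mod int (N * p))"
proof -
  have "[b = 1] (mod int p)"
    using assms by (meson cong_dvd_modulus of_nat_dvd_iff)
  then have "[(\<Sum>i<p. b ^ i) = (\<Sum>i<p. 1 ^ i)] (mod int p)"
    by (intro cong_sum cong_pow)
  then have "int p dvd (\<Sum>i<p. b ^ i)"
    by (simp add: cong_def mod_eq_0_iff_dvd)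
  moreover have "int N dvd b - 1"
    using assms(1) by (simp add: cong_iff_dvd_diff)
  ultimately have "int N * int p dvd (b - 1) * (\<Sum>i<p. b ^ i)"
    by (rule mult_dvd_mono[rotated])
  then show ?thesis
    by (simp add: cong_iff_dvd_diff power_diff_1_eq)
qed

lemma cong_1_power_lift_prime_factors:
  fixes b :: int and N m :: nat
  assumes "m > 0" and "[b = 1] (mod int N)"
    and "\<And>p. prime p \<Longrightarrow> p dvd m \<Longrightarrow> p dvd N"
  shows "[b ^ m = 1] (mod int (N * m))"
  using assms
proof (induction m arbitrary: b N rule: prime_divisors_induct)
  case zero
  then show ?case by simp
next
  case (unit m)
  then show ?case by simp
next
  case (factor p m)
  have "[b ^ p = 1] (mod int (N * p))"
    using factor.prems factor.hyps by (intro cong_1_power_lift) auto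
  \<comment> \<open>The base becomes \<open>b ^ p\<close> and the modulus \<open>N * p\<close>,
    hence both are arbitrary in the induction; primes dividing \<open>m\<close> divide
    \<open>N\<close> and so \<open>N * p\<close>.\<close>
  then have "[(b ^ p) ^ m = 1] (mod int (N * p * m))"
    using factor.prems by (intro factor.IH) auto
  then show ?case
    by (simp add: power_mult mult.assoc)
qed

text \<open>Coprimality and the congruences defining \<open>ord\<close> depend only on the residue
  class of \<open>a\<close>. This gives access to \<open>ord_divides\<close> and
  \<open>ord_gt_0_iff\<close> on natural numbers.\<close>

lemma ord_int_eq_ord_nat_mod:
  fixes a :: int and n :: nat
  assumes "n > 0"
  shows "ord (int n) a = ord n (nat (a mod int n))"
proof -
  define r where "r = nat (a mod int n)"
  have r: "int r = a mod int n"
    using assms by (simp add: r_def)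
  have "coprime (int n) a \<longleftrightarrow> coprime (int n) (int r)"
    using assms by (simp add: r)
  then have "coprime (int n) a \<longleftrightarrow> coprime n r"
    by (simp only: coprime_int_iff)
  moreover have "[a ^ d = 1] (mod int n) \<longleftrightarrow> [r ^ d = 1] (mod n)" for d
  proof -
    have "[a ^ d = 1] (mod int n) \<longleftrightarrow> [int r ^ d = 1] (mod int n)"
      by (simp add: r cong_def power_mod)
    also have "\<dots> \<longleftrightarrow> [int (r ^ d) = int 1] (mod int n)"
      by simp
    also have "\<dots> \<longleftrightarrow> [r ^ d = 1] (mod n)"
      by (simp only: cong_int_iff)
    finally show ?thesis .
  qed
  ultimately show ?thesis
    by (simp add: ord_def flip: r_def)
qed

lemma ord_int_dvd_iff:
  fixes a :: int and n :: nat
  assumes "n > 0"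
  shows "ord (int n) a dvd d \<longleftrightarrow> [a ^ d = 1] (mod int n)"
proof -
  define r where "r = nat (a mod int n)"
  have r: "int r = a mod int n"
    using assms by (simp add: r_def)
  have "ord (int n) a dvd d \<longleftrightarrow> [r ^ d = 1] (mod n)"
    by (simp only: ord_int_eq_ord_nat_mod[OF assms] ord_divides r_def)
  also have "\<dots> \<longleftrightarrow> [int (r ^ d) = int 1] (mod int n)"
    by (simp only: cong_int_iff)
  also have "\<dots> \<longleftrightarrow> [a ^ d = 1] (mod int n)"
    by (simp add: r cong_def power_mod)
  finally show ?thesis .
qed

lemma ord_int_pos:
  fixes a :: int and n :: nat
  assumes "n > 0" and "coprime a (int n)"
  shows "ord (int n) a > 0"
proof -
  have "coprime (int n) (int (nat (a mod int n)))"
    using assms by (simp add: coprime_commute[of a])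
  then show ?thesis
    by (simp only: ord_int_eq_ord_nat_mod[OF assms(1)] ord_gt_0_iff coprime_int_iff)
qed

lemma prime_dvd_rad:
  assumes "n > 0" and "prime p" and "p dvd n"
  shows "p dvd rad n"
  unfolding rad_def using assms by (intro dvd_prodI) (auto simp: prime_factors_dvd)

theorem proposition2p2:
  fixes n1 n2 :: nat and a :: int
  assumes "n1 > 0" and "n2 > 0"
    and "rad n1 dvd n2" and "n2 dvd n1"
  shows "alpha n1 a dvd alpha n2 a"
proof (cases "coprime a (int n2)")
  \<comment> \<open>The default value \<open>alpha n2 a = 0\<close> is divisible by
    everything.\<close>
  case False
  then show ?thesis by (simp add: alpha_def)
next
  case True
  define d where "d = alpha n2 a"
  obtain m where m: "n1 = n2 * m"
    using assms(4) by blast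
  have d: "d = ord (int n2) (a ^ n2)"
    using True by (simp add: d_def alpha_def)
  have "d > 0"
    unfolding d using True assms(2) by (intro ord_int_pos) auto
  have "[(a ^ n2) ^ d = 1] (mod int n2)"
    using assms(2) by (simp add: d flip: ord_int_dvd_iff)
  \<comment> \<open>Such a \<open>p\<close> divides \<open>n1\<close>, hence \<open>rad n1\<close>,
    hence \<open>n2\<close>.\<close>
  moreover have "p dvd n2" if "prime p" "p dvd m" for p
    using that assms(1,3) m prime_dvd_rad[of n1 p] by (meson dvd_mult dvd_trans)
  ultimately have "[((a ^ n2) ^ d) ^ m = 1] (mod int (n2 * m))"
    using assms(1) m by (intro cong_1_power_lift_prime_factors) auto
  then have one: "[(a ^ n1) ^ d = 1] (mod int n1)"
    by (simp add: m power_mult[symmetric] mult_ac)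
  \<comment> \<open>A power congruent to 1 is a unit modulo \<open>n1\<close>. Since
    \<open>n1\<close> and \<open>d\<close> are positive, \<open>a\<close> itself is a unit, so
    \<open>alpha n1 a\<close> is an order and not the default 0.\<close>
  then have "coprime ((a ^ n1) ^ d) (int n1)"
    by (metis cong_imp_coprime cong_sym coprime_1_left)
  then have "coprime a (int n1)"
    using \<open>d > 0\<close> assms(1) by simp
  then show ?thesis
    using one assms(1) unfolding d_def[symmetric] by (simp add: alpha_def ord_int_dvd_iff)
qed

end
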